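(* For every $k\in\mathbb{N}$, $$2k\le N_{\min}(k).$$
   Context: $\mathbb{N}$ denotes the positive integers, $p_i$ the $i$-th prime ($p_1=2$), and $p_k\#=\prod_{i=1}^k p_i$. For $k\in\mathbb{N}$, let $c_{k,1}<c_{k,2}<\dots$ be the increasing enumeration of all $x\in\mathbb{N}$ with $\gcd(x,p_k\#)=1$, and let $D(k)=(c_{k,i+1}-c_{k,i})_{i\ge1}$ be the sequence of differences between consecutive such numbers; $m\in D(k)$ means that $m$ occurs as a term of this sequence. $N_{\min}(k)$ is the largest even $N\in\mathbb{N}$ such that $2n\in D(k)$ for all $n\in\mathbb{N}$ with $n\le N/2$. (Such an $N$ exists, since $2\in D(k)$ and $D(k)$ is bounded.) *)

theory Defs
  imports "HOL-Library.Infinite_Set" "HOL-Computational_Algebra.Primes"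
begin

text \<open>All sequences are indexed from 1 (the value at index 0 is meaningless), whereas
  \<^const>\<open>enumerate\<close> counts from 0.\<close>

definition nth_prime :: "nat \<Rightarrow> nat" where
  "nth_prime i = enumerate {p. prime p} (i - 1)"

definition primorial :: "nat \<Rightarrow> nat" where
  "primorial k = (\<Prod>i = 1..k. nth_prime i)"

definition coprime_seq :: "nat \<Rightarrow> nat \<Rightarrow> nat" where
  "coprime_seq k i = enumerate {x. 0 < x \<and> gcd x (primorial k) = 1} (i - 1)"

text \<open>The truncated subtraction is harmless, because \<^term>\<open>coprime_seq k\<close> is increasing.\<close>

definition diff_seq :: "nat \<Rightarrow> nat \<Rightarrow> nat" where
  "diff_seq k i = coprime_seq k (i + 1) - coprime_seq k i"

text \<open>The set of terms of the sequence $D(k)$.\<close>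

definition D :: "nat \<Rightarrow> nat set" where
  "D k = diff_seq k ` {1..}"

definition N_min :: "nat \<Rightarrow> nat" where
  "N_min k = (GREATEST N. 0 < N \<and> even N \<and> (\<forall>n. 1 \<le> n \<and> n \<le> N div 2 \<longrightarrow> 2 * n \<in> D k))"

end

theory Submission
  imports Defs "HOL-Number_Theory.Cong"
begin

text \<open>
  Every even number \<open>2 * n\<close> with \<open>1 \<le> n \<le> k\<close> occurs in \<open>D k\<close>. To produce such a gap one needs an
  \<open>x\<close> such that \<open>x\<close> and \<open>x + 2 * n\<close> are coprime to the primorial while nothing strictly between
  them is. Odd offsets are taken care of by the prime \<open>2\<close>, which leaves the \<open>n - 1\<close> inner
  positions \<open>x + 2 * i\<close> to be hit by the \<open>k - 1 \<ge> n - 1\<close> odd primes. It suffices that each odd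
  prime, taken in increasing order, hits one further position as long as some are left.

  By the Chinese remainder theorem the residue of \<open>x\<close> modulo the next prime \<open>q\<close> is at our disposal,
  and \<open>x \<equiv> -2 * i\<close> hits position \<open>i\<close> without spoiling the end points unless \<open>q\<close> divides \<open>i\<close> or
  \<open>n - i\<close>. At most \<open>2 * (n - 1) / q\<close> positions are excluded in this way. If \<open>q\<close> is the \<open>j\<close>-th odd
  prime, then \<open>q \<ge> 2 * j + 1\<close>, and \<open>n - j\<close> positions are left in the worst case; since
  \<open>2 * (n - 1) < (2 * j + 1) * (n - j)\<close>, some remaining position is admissible
  (lemma \<open>admissible_position_exists\<close>). So the greedy choice never gets stuck, and induction over the
  primes yields lemma \<open>few_coprime_positions\<close>. A bound on the gaps finally ensures that the maximum
  that defines \<open>N_min k\<close> exists, so that it dominates \<open>2 * k\<close>.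
\<close>

section \<open>Primes and primorials\<close>

lemma prime_nth_prime: "prime (nth_prime i)"
  using enumerate_in_set[OF primes_infinite] by (simp add: nth_prime_def)

lemma nth_prime_less: "1 \<le> i \<Longrightarrow> i < j \<Longrightarrow> nth_prime i < nth_prime j"
  unfolding nth_prime_def by (rule enumerate_mono[OF _ primes_infinite]) simp

lemma nth_prime_1: "nth_prime 1 = 2"
  unfolding nth_prime_def
  by (simp add: enumerate_0) (rule Least_equality, auto intro: prime_ge_2_nat)

text \<open>From the second one on, primes are odd, hence consecutive ones differ by at least \<open>2\<close>.\<close>

lemma nth_prime_Suc_ge:
  assumes "1 \<le> k"
  shows "2 * k + 1 \<le> nth_prime (Suc k)"
  using assms
proof (induction k rule: nat_induct_at_least)
  case base
  show ?case using nth_prime_less[of 1 2] nth_prime_1 by (simp add: numeral_2_eq_2)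
next
  case (Suc k)
  have less: "nth_prime (Suc k) < nth_prime (Suc (Suc k))"
    by (rule nth_prime_less) auto
  moreover have "odd (nth_prime (Suc k))" "odd (nth_prime (Suc (Suc k)))"
    using Suc less by (intro prime_odd_nat prime_nth_prime; linarith)+
  ultimately have "nth_prime (Suc k) + 2 \<le> nth_prime (Suc (Suc k))"
    by presburger
  with Suc show ?case by simp
qed

lemma primorial_Suc: "primorial (Suc k) = primorial k * nth_prime (Suc k)"
  by (simp add: primorial_def)

lemma primorial_1: "primorial 1 = 2"
  using nth_prime_1 by (simp add: primorial_def)

lemma primorial_pos: "0 < primorial k"
  unfolding primorial_def by (simp add: prime_gt_0_nat prime_nth_prime)

lemma even_primorial: "1 \<le> k \<Longrightarrow> even (primorial k)"
  by (induction k rule: nat_induct_at_least) (use primorial_1 in \<open>auto simp: primorial_Suc\<close>)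

lemma coprime_primorial_next_prime: "coprime (primorial k) (nth_prime (Suc k))"
  unfolding primorial_def
proof (rule prod_coprime_left)
  fix i assume "i \<in> {1..k}"
  then have "nth_prime i \<noteq> nth_prime (Suc k)"
    using nth_prime_less[of i "Suc k"] by simp
  then show "coprime (nth_prime i) (nth_prime (Suc k))"
    by (simp add: primes_coprime prime_nth_prime)
qed

section \<open>The greedy covering\<close>

lemma card_multiples_le:
  fixes q n :: nat
  assumes "0 < q"
  shows "q * card {i \<in> {1..n}. q dvd i} \<le> n"
proof -
  have "{i \<in> {1..n}. q dvd i} \<subseteq> (*) q ` {1..n div q}"
  proof
    fix i assume "i \<in> {i \<in> {1..n}. q dvd i}"
    then obtain m where "i = q * m" "1 \<le> q * m" "q * m \<le> n" by auto
    with assms show "i \<in> (*) q ` {1..n div q}"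
      by (auto simp: less_eq_div_iff_mult_less_eq mult.commute intro!: imageI)
  qed
  then have "card {i \<in> {1..n}. q dvd i} \<le> n div q"
    by (rule surj_card_le[rotated, where f = "(*) q", THEN order_trans]) auto
  then have "q * card {i \<in> {1..n}. q dvd i} \<le> q * (n div q)"
    by simp
  also have "\<dots> \<le> n" by simp
  finally show ?thesis .
qed

text \<open>
  Reflecting \<open>i\<close> to \<open>n - i\<close> shows that each of the two conditions excludes at most \<open>(n - 1) / q\<close>
  positions, and together they exclude fewer than the \<open>n - j\<close> available ones.
\<close>

lemma admissible_position_exists:
  fixes R :: "nat set"
  assumes "R \<subseteq> {1..<n}" "1 \<le> j" "j < n" "n - j \<le> card R" "2 * j + 1 \<le> q"
  obtains i where "i \<in> R" "\<not> q dvd i" "\<not> q dvd n - i"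
proof -
  let ?A = "{i \<in> {1..n - 1}. q dvd i}"
  let ?B = "(\<lambda>i. n - i) ` ?A"
  have "\<not> R \<subseteq> ?A \<union> ?B"
  proof
    assume "R \<subseteq> ?A \<union> ?B"
    then have "card R \<le> card (?A \<union> ?B)"
      by (intro card_mono) auto
    also have "\<dots> \<le> card ?A + card ?B"
      by (rule card_Un_le)
    also have "\<dots> \<le> 2 * card ?A"
      using card_image_le[of ?A "\<lambda>i. n - i"] by simp
    finally have "n - j \<le> 2 * card ?A"
      using assms(4) by simp
    then have "(2 * j + 1) * (n - j) \<le> q * (2 * card ?A)"
      using assms(5) by (rule mult_le_mono[rotated])
    also have "\<dots> \<le> 2 * (n - 1)"
      using card_multiples_le[of q "n - 1"] assms(5) by simp
    finally have le: "(2 * j + 1) * (n - j) \<le> 2 * (n - 1)" .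
    obtain m j' where n: "n = j + Suc m" and j: "j = Suc j'"
      using assms(2,3) by (metis One_nat_def Suc_le_D less_iff_Suc_add add_Suc_right)
    from le show False
      unfolding n j by (simp add: algebra_simps)
  qed
  then obtain i where i: "i \<in> R" "i \<notin> ?A" "i \<notin> ?B" by auto
  have range: "1 \<le> i" "i < n" using i(1) assms(1) by auto
  have "\<not> q dvd n - i"
  proof
    assume "q dvd n - i"
    with range have "n - (n - i) \<in> ?B" by (intro imageI) auto
    with i range show False by simp
  qed
  moreover have "\<not> q dvd i" using i range by auto
  ultimately show thesis using that i(1) by blast
qed

text \<open>
  The new \<open>x\<close> of the induction step agrees with the old one modulo \<open>primorial k\<close>, hence the set of
  uncovered inner positions can only shrink, and it loses an element whenever the bound demands it.
  By truncated subtraction the bound is \<open>0\<close>, and the covering complete, as soon as \<open>k \<ge> n\<close>.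
\<close>

lemma few_coprime_positions:
  assumes "1 \<le> k" "1 \<le> n"
  shows "\<exists>x. coprime x (primorial k) \<and> coprime (x + 2 * n) (primorial k) \<and>
    card {i \<in> {1..<n}. coprime (x + 2 * i) (primorial k)} \<le> n - k"
  using assms(1)
proof (induction k rule: nat_induct_at_least)
  case base
  have "card {i \<in> {1..<n}. coprime (1 + 2 * i) (primorial 1)} \<le> card {1..<n}"
    by (rule card_mono) auto
  moreover have "coprime (1 + 2 * n) 2" by simp
  ultimately show ?case using primorial_1 by (intro exI[of _ 1]) simp
next
  case (Suc k)
  define P where "P = primorial k"
  define q where "q = nth_prime (Suc k)"
  obtain x where x: "coprime x P" "coprime (x + 2 * n) P"
    and card_x: "card {i \<in> {1..<n}. coprime (x + 2 * i) P} \<le> n - k"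
    using Suc.IH unfolding P_def by blast
  define R where "R = {i \<in> {1..<n}. coprime (x + 2 * i) P}"
  have "prime q" unfolding q_def by (rule prime_nth_prime)
  have q_ge: "2 * k + 1 \<le> q" unfolding q_def using Suc.hyps by (intro nth_prime_Suc_ge) simp
  with Suc.hyps have "3 \<le> q" by simp
  have "coprime P q" unfolding P_def q_def by (rule coprime_primorial_next_prime)

  \<comment> \<open>\<open>c\<close> is the residue for the new \<open>x\<close> modulo \<open>q\<close>: both end points survive, and one further
    position is covered if that is still necessary.\<close>
  obtain c where c: "\<not> q dvd c" "\<not> q dvd c + 2 * n"
    and progress: "card {i \<in> R. \<not> q dvd c + 2 * i} \<le> n - Suc k"
  proof (cases "card R \<le> n - Suc k")
    case True
    have small: "card {i \<in> R. \<not> q dvd c + 2 * i} \<le> n - Suc k" for c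
      by (rule order_trans[OF card_mono True]) (auto simp: R_def)
    \<comment> \<open>One of the residues \<open>1\<close> and \<open>2\<close> will do: \<open>q \<ge> 3\<close> divides neither of them, nor both of the
      consecutive numbers \<open>1 + 2 * n\<close> and \<open>2 + 2 * n\<close>.\<close>
    have "\<not> q dvd 1" "\<not> q dvd 2" using \<open>3 \<le> q\<close> by (auto dest: dvd_imp_le)
    moreover have "\<not> (q dvd 1 + 2 * n \<and> q dvd 2 + 2 * n)"
    proof
      assume "q dvd 1 + 2 * n \<and> q dvd 2 + 2 * n"
      then have "q dvd (2 + 2 * n) - (1 + 2 * n)" by (intro dvd_diff_nat) auto
      with \<open>\<not> q dvd 1\<close> show False by simp
    qed
    ultimately show thesis using that small by blast
  next
    case False
    then have "k < n" "n - k \<le> card R"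
      using card_x by (auto simp: R_def)
    then obtain i where i: "i \<in> R" "\<not> q dvd i" "\<not> q dvd n - i"
      using admissible_position_exists[of R n k q, OF _ Suc.hyps] q_ge unfolding R_def by blast
    \<comment> \<open>A natural number congruent to \<open>-2 * i\<close> modulo \<open>q\<close>.\<close>
    define c where "c = 2 * i * (q - 1)"
    have c_i: "c + 2 * i = 2 * i * q"
      unfolding c_def using \<open>3 \<le> q\<close> by (simp add: diff_mult_distrib2)
    have "\<not> q dvd 2" using \<open>3 \<le> q\<close> by (auto dest: dvd_imp_le)
    have "\<not> q dvd c"
    proof
      assume "q dvd c"
      then have "q dvd 2 * i" using c_i by (metis dvd_add_right_iff dvd_triv_right)
      with \<open>prime q\<close> \<open>\<not> q dvd 2\<close> i show False by (simp add: prime_dvd_mult_iff)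
    qed
    moreover have "\<not> q dvd c + 2 * n"
    proof
      assume "q dvd c + 2 * n"
      moreover have "c + 2 * n = 2 * i * q + 2 * (n - i)"
        using c_i i(1) unfolding R_def by auto
      ultimately have "q dvd 2 * (n - i)" by (metis dvd_add_right_iff dvd_triv_right)
      with \<open>prime q\<close> \<open>\<not> q dvd 2\<close> i show False by (simp add: prime_dvd_mult_iff)
    qed
    moreover have "card {i \<in> R. \<not> q dvd c + 2 * i} \<le> n - Suc k"
    proof -
      have "card {i \<in> R. \<not> q dvd c + 2 * i} \<le> card (R - {i})"
        using c_i by (intro card_mono) (auto simp: R_def)
      then show ?thesis using i(1) card_x unfolding R_def by simp
    qed
    ultimately show thesis using that by blast
  qed
  obtain y where y: "[y = x] (mod P)" "[y = c] (mod q)"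
    using binary_chinese_remainder_nat[OF \<open>coprime P q\<close>] by blast
  have coprime_P: "coprime (y + m) P \<longleftrightarrow> coprime (x + m) P" for m
    using cong_imp_coprime[OF cong_add[OF y(1) cong_refl]]
      cong_imp_coprime[OF cong_add[OF cong_sym[OF y(1)] cong_refl]]
    by blast
  have dvd_q: "q dvd y + m \<longleftrightarrow> q dvd c + m" for m
    by (rule cong_dvd_iff) (rule cong_add[OF y(2) cong_refl])
  have coprime_iff: "coprime (y + m) (primorial (Suc k)) \<longleftrightarrow>
      coprime (x + m) P \<and> \<not> q dvd c + m" for m
  proof -
    have "coprime (y + m) q \<longleftrightarrow> \<not> q dvd y + m"
      using prime_imp_coprime[OF \<open>prime q\<close>] \<open>prime q\<close>
      by (auto simp: coprime_commute[of q] dest: coprime_absorb_right)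
    then show ?thesis
      by (simp add: primorial_Suc flip: P_def q_def coprime_P dvd_q)
  qed
  have "{i \<in> {1..<n}. coprime (y + 2 * i) (primorial (Suc k))} = {i \<in> R. \<not> q dvd c + 2 * i}"
    by (auto simp: coprime_iff R_def)
  with progress x c show ?case
    using coprime_iff[of 0] coprime_iff[of "2 * n"] by (intro exI[of _ y]) simp
qed

section \<open>Gaps between consecutive coprime numbers\<close>

lemma coprime_add_primorial: "gcd (a + m * primorial k) (primorial k) = gcd a (primorial k)"
  by (metis add.commute gcd.commute gcd_add_mult)

lemma infinite_coprime_numbers: "infinite {x. 0 < x \<and> gcd x (primorial k) = 1}"
proof (rule infinite_super)
  show "range (\<lambda>m. 1 + m * primorial k) \<subseteq> {x. 0 < x \<and> gcd x (primorial k) = 1}"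
    using coprime_add_primorial[of 1] by auto
  show "infinite (range (\<lambda>m. 1 + m * primorial k))"
    by (rule range_inj_infinite) (use primorial_pos[of k] in \<open>auto intro!: injI\<close>)
qed

lemma gap_in_D:
  assumes "0 < x" "coprime x (primorial k)" "0 < d" "coprime (x + d) (primorial k)"
    and gap: "\<And>e. 0 < e \<Longrightarrow> e < d \<Longrightarrow> \<not> coprime (x + e) (primorial k)"
  shows "d \<in> D k"
proof -
  let ?S = "{x. 0 < x \<and> gcd x (primorial k) = 1}"
  have "x \<in> ?S" using assms by simp
  from enumerate_Ex[OF infinite_coprime_numbers this] obtain i where i: "enumerate ?S i = x" ..
  have "enumerate ?S (Suc i) = (LEAST s. s \<in> ?S \<and> x < s)"
    using enumerate_Suc''[OF infinite_coprime_numbers] i by simp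
  also have "\<dots> = x + d"
  proof (rule Least_equality)
    show "x + d \<in> ?S \<and> x < x + d" using assms by simp
  next
    fix s assume s: "s \<in> ?S \<and> x < s"
    show "x + d \<le> s"
    proof (rule ccontr)
      assume "\<not> x + d \<le> s"
      with s have "0 < s - x" "s - x < d" by linarith+
      with s gap[of "s - x"] show False by (simp add: coprime_iff_gcd_eq_1)
    qed
  qed
  finally have "diff_seq k (Suc i) = d"
    using i by (simp add: diff_seq_def coprime_seq_def)
  then show ?thesis unfolding D_def by force
qed

text \<open>Coprimality to the primorial is periodic, so the next coprime number comes after at most
  one period.\<close>

lemma D_le_primorial:
  assumes "d \<in> D k"
  shows "d \<le> primorial k"
proof -
  let ?S = "{x. 0 < x \<and> gcd x (primorial k) = 1}"
  obtain i where "1 \<le> i" "d = diff_seq k i" using assms unfolding D_def by auto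
  then obtain j where d: "d = enumerate ?S (Suc j) - enumerate ?S j"
    by (cases i) (auto simp: diff_seq_def coprime_seq_def)
  have "enumerate ?S j \<in> ?S"
    by (rule enumerate_in_set[OF infinite_coprime_numbers])
  then have "enumerate ?S j + primorial k \<in> ?S \<and> enumerate ?S j < enumerate ?S j + primorial k"
    using coprime_add_primorial[of _ 1] primorial_pos by simp
  then have "enumerate ?S (Suc j) \<le> enumerate ?S j + primorial k"
    unfolding enumerate_Suc''[OF infinite_coprime_numbers] by (rule Least_le)
  with d show ?thesis by simp
qed

lemma even_gap_in_D:
  assumes "1 \<le> n" "n \<le> k"
  shows "2 * n \<in> D k"
proof -
  have "1 \<le> k" using assms by simp
  then obtain x where x: "coprime x (primorial k)" "coprime (x + 2 * n) (primorial k)"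
    and "card {i \<in> {1..<n}. coprime (x + 2 * i) (primorial k)} \<le> n - k"
    using few_coprime_positions assms(1) by blast
  then have none: "{i \<in> {1..<n}. coprime (x + 2 * i) (primorial k)} = {}"
    using assms(2) by simp
  have "even (primorial k)" using \<open>1 \<le> k\<close> by (rule even_primorial)
  then have "odd x" using x(1) by (auto dest: coprime_common_divisor)
  show ?thesis
  proof (rule gap_in_D[OF _ x(1) _ x(2)])
    show "0 < x" using \<open>odd x\<close> by (rule odd_pos)
    show "0 < 2 * n" using assms by simp
    fix e assume e: "0 < e" "e < 2 * n"
    show "\<not> coprime (x + e) (primorial k)"
    proof (cases "even e")
      case True
      then obtain i where "e = 2 * i" by auto
      with e none show ?thesis by auto
    next
      case False
      with \<open>odd x\<close> have "even (x + e)" by simp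
      with \<open>even (primorial k)\<close> show ?thesis by (auto dest: coprime_common_divisor)
    qed
  qed
qed

theorem corollary2p8:
  fixes k :: nat
  assumes "1 \<le> k"
  shows "2 * k \<le> N_min k"
  unfolding N_min_def
proof (rule Greatest_le_nat)
  show "0 < 2 * k \<and> even (2 * k) \<and> (\<forall>n. 1 \<le> n \<and> n \<le> 2 * k div 2 \<longrightarrow> 2 * n \<in> D k)"
    using assms even_gap_in_D by auto
next
  fix N
  assume N: "0 < N \<and> even N \<and> (\<forall>n. 1 \<le> n \<and> n \<le> N div 2 \<longrightarrow> 2 * n \<in> D k)"
  then have "2 * (N div 2) \<in> D k" by (auto elim!: evenE)
  with N show "N \<le> primorial k" using D_le_primorial[of N k] by simp
qed

end
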